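(* Let $H$ be a fixed connected simple undirected graph with vertex set $[k]$, and let $\mathit{pw}(H)$ denote its pathwidth. For $n\ge 1$, let $\mathrm{Hom}_{H,n}$ be the homomorphism polynomial of $H$ (defined in the context). Then the minimum size of a monotone algebraic branching program computing $\mathrm{Hom}_{H,n}$ is $\Theta\bigl(n^{\mathit{pw}(H)+1}\bigr)$ as $n\to\infty$, where the constants hidden in $\Theta$ may depend on $H$.
   Context: A homomorphism from $H$ to $G$ is a map $\phi:V(H)\to V(G)$ with $\{i,j\}\in E(H)\Rightarrow\{\phi(i),\phi(j)\}\in E(G)$; write $\phi(\{i,j\})=\{\phi(i),\phi(j)\}$. The homomorphism polynomial is $\mathrm{Hom}_{H,n}=\sum_{\phi}\prod_{e\in E(H)}x_{\phi(e)}$ over $\mathbb{Q}$ in the variables $x_{\{u,v\}}$ ($u\ne v\in[n]$), where $\phi$ ranges over all homomorphisms from $H$ to the complete graph $K_n$ on $[n]$. An algebraic branching program (ABP) is a DAG with a unique source $s$ and unique sink $t$, each edge labeled by a variable or a constant in $\mathbb{Q}$; it computes the sum over all $s$–$t$ paths of the product of the edge labels on the path. It is monotone if all constants are non-negative; its size is its number of edges. A path decomposition of $H$ is a sequence (path) of bags $B_1,\dots,B_r\subseteq V(H)$ such that every edge of $H$ lies in some bag and for each vertex $i$ the bags containing $i$ form a contiguous subpath; its width is the maximum bag size minus one, and $\mathit{pw}(H)$ is the minimum width of a path decomposition.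
   Formalization: The formal theorem assumes k ≥ 2: for the one-vertex graph the homomorphism polynomial is the constant n, computed by a program with a single edge, so the claimed Θ(n) fails there. *)

theory Defs
  imports
    "HOL-Library.FuncSet"
    "HOL-Library.Poly_Mapping"
    "HOL-Library.Landau_Symbols"
    "Graph_Theory.Pair_Digraph"
begin

section \<open>Simple undirected graphs\<close>

definition complete_edges :: "'a set \<Rightarrow> 'a set set" where
  "complete_edges V = {e. e \<subseteq> V \<and> card e = 2}"

definition simple_graph :: "'a set \<Rightarrow> 'a set set \<Rightarrow> bool" where
  "simple_graph V E \<longleftrightarrow> finite V \<and> E \<subseteq> complete_edges V"

definition connected_graph :: "'a set \<Rightarrow> 'a set set \<Rightarrow> bool" where
  "connected_graph V E \<longleftrightarrow> V \<noteq> {} \<and> (\<forall>u\<in>V. \<forall>v\<in>V. (u, v) \<in> {(a, b). {a, b} \<in> E}\<^sup>*)"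

text \<open>Maps are taken extensional, so that each map on \<open>V\<close> is counted once.\<close>

definition graph_homs :: "'a set \<Rightarrow> 'a set set \<Rightarrow> 'b set \<Rightarrow> 'b set set \<Rightarrow> ('a \<Rightarrow> 'b) set" where
  "graph_homs V E W F = {\<phi> \<in> V \<rightarrow>\<^sub>E W. \<forall>e\<in>E. \<phi> ` e \<in> F}"


section \<open>Pathwidth\<close>

text \<open>A contiguous subpath is nonempty, so every vertex lies in some bag.\<close>

definition path_decomposition :: "'a set \<Rightarrow> 'a set set \<Rightarrow> 'a set list \<Rightarrow> bool" where
  "path_decomposition V E Bs \<longleftrightarrow>
     (\<forall>B\<in>set Bs. B \<subseteq> V) \<and>
     (\<forall>e\<in>E. \<exists>B\<in>set Bs. e \<subseteq> B) \<and>
     (\<forall>i\<in>V. \<exists>a b. a \<le> b \<and> b < length Bs \<and> {j. j < length Bs \<and> i \<in> Bs ! j} = {a..b})"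

text \<open>For nonempty \<open>V\<close> some bag is nonempty, so the subtraction does not truncate.\<close>

definition decomposition_width :: "'a set list \<Rightarrow> nat" where
  "decomposition_width Bs = Max (card ` set Bs) - 1"

definition pathwidth :: "'a set \<Rightarrow> 'a set set \<Rightarrow> nat" where
  "pathwidth V E = (LEAST w. \<exists>Bs. path_decomposition V E Bs \<and> decomposition_width Bs = w)"


section \<open>Polynomials over the rationals and homomorphism polynomials\<close>

type_synonym 'x qpoly = "('x \<Rightarrow>\<^sub>0 nat) \<Rightarrow>\<^sub>0 rat"

definition pvar :: "'x \<Rightarrow> 'x qpoly" where
  "pvar x = Poly_Mapping.single (Poly_Mapping.single x 1) 1"

definition pconst :: "rat \<Rightarrow> 'x qpoly" where
  "pconst c = Poly_Mapping.single 0 c"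

text \<open>The variable \<open>x\<^bsub>{u,v}\<^esub>\<close> is indexed by the two-element set \<open>{u, v}\<close>.\<close>

definition hom_poly :: "'a set \<Rightarrow> 'a set set \<Rightarrow> nat \<Rightarrow> nat set qpoly" where
  "hom_poly V E n =
     (\<Sum>\<phi> \<in> graph_homs V E {1..n} (complete_edges {1..n}). \<Prod>e\<in>E. pvar (\<phi> ` e))"


section \<open>Algebraic branching programs\<close>

datatype 'x abp_label = Var 'x | Const rat

primrec label_poly :: "'x abp_label \<Rightarrow> 'x qpoly" where
  "label_poly (Var x) = pvar x"
| "label_poly (Const c) = pconst c"

text \<open>Naming the nodes by natural numbers is no restriction, as programs are finite.\<close>

record 'x abp =
  abp_graph :: "nat pair_pre_digraph"
  abp_source :: nat
  abp_sink :: nat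
  abp_label :: "nat \<times> nat \<Rightarrow> 'x abp_label"

text \<open>\<open>X\<close> is the set of variables that may occur as labels.\<close>

definition is_abp :: "'x set \<Rightarrow> 'x abp \<Rightarrow> bool" where
  "is_abp X A \<longleftrightarrow>
     pair_fin_digraph (abp_graph A) \<and>
     acyclic (parcs (abp_graph A)) \<and>
     {v \<in> pverts (abp_graph A). in_arcs (with_proj (abp_graph A)) v = {}} = {abp_source A} \<and>
     {v \<in> pverts (abp_graph A). out_arcs (with_proj (abp_graph A)) v = {}} = {abp_sink A} \<and>
     (\<forall>e \<in> parcs (abp_graph A). \<forall>x. abp_label A e = Var x \<longrightarrow> x \<in> X)"

definition monotone_abp :: "'x abp \<Rightarrow> bool" where
  "monotone_abp A \<longleftrightarrow> (\<forall>e \<in> parcs (abp_graph A). \<forall>c. abp_label A e = Const c \<longrightarrow> 0 \<le> c)"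

definition abp_poly :: "'x abp \<Rightarrow> 'x qpoly" where
  "abp_poly A =
     (\<Sum>p \<in> {p. pre_digraph.apath (with_proj (abp_graph A)) (abp_source A) p (abp_sink A)}.
        \<Prod>e\<leftarrow>p. label_poly (abp_label A e))"

definition abp_size :: "'x abp \<Rightarrow> nat" where
  "abp_size A = card (parcs (abp_graph A))"

text \<open>
  If no monotone program over \<open>X\<close> computes \<open>f\<close>, the value is one fixed unspecified number,
  the same for all such \<open>f\<close> and \<open>X\<close>.  An unbounded lower bound on the minimum size of a
  sequence of polynomials therefore entails that programs exist for almost all of them.
\<close>

definition min_monotone_abp_size :: "'x set \<Rightarrow> 'x qpoly \<Rightarrow> nat" where
  "min_monotone_abp_size X f =
     (LEAST m. \<exists>A. is_abp X A \<and> monotone_abp A \<and> abp_poly A = f \<and> abp_size A = m)"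

end

theory Submission
  imports Defs
begin

text \<open>
  Upper bound: a program sweeps over an optimal path decomposition, remembering the images of the
  vertices of the current bag; its paths correspond to the maps from \<open>V\<close> to \<open>{1..n}\<close>.

  Lower bound: a path computing the monomial of an injective map lists the edges of a copy of
  \<open>H\<close> in some order, and such an order induces a path decomposition, so at some arc at least
  \<open>pathwidth + 1\<close> vertices are met on both sides.  If two injective maps are routed through the same
  arc, their paths can be spliced there.  As nothing cancels, the result is again a monomial of the
  homomorphism polynomial and so meets at most \<open>card V\<close> vertices; hence the two images share at
  least \<open>pathwidth + 1\<close> vertices.  Therefore an arc serves only
  \<open>O(n ^ (card V - pathwidth - 1))\<close> of the \<open>\<Omega>(n ^ card V)\<close> injective maps.
\<close>

section \<open>Paths in branching programs\<close>

lemma pcas_append: "pcas u (p @ q) w \<longleftrightarrow> (\<exists>v. pcas u p v \<and> pcas v q w)"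
  by (induction p arbitrary: u) auto

lemma pawalk_verts_reachable:
  "pcas u p v \<Longrightarrow> set p \<subseteq> R \<Longrightarrow> w \<in> set (pawalk_verts u p) \<Longrightarrow> (u, w) \<in> R\<^sup>*"
proof (induction p arbitrary: u)
  case (Cons a p)
  then show ?case
    by (cases a) (auto intro: converse_rtrancl_into_rtrancl)
qed auto

lemma acyclic_distinct_pawalk_verts:
  assumes "acyclic R" "pcas u p v" "set p \<subseteq> R"
  shows "distinct (pawalk_verts u p)"
  using assms(2,3)
proof (induction p arbitrary: u)
  case (Cons a p)
  have "fst a \<notin> set (pawalk_verts (snd a) p)"
  proof
    assume "fst a \<in> set (pawalk_verts (snd a) p)"
    then have "(snd a, fst a) \<in> R\<^sup>*"
      using pawalk_verts_reachable[of "snd a" p v R] Cons.prems by auto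
    moreover have "(fst a, snd a) \<in> R" using Cons.prems by auto
    ultimately have "(fst a, fst a) \<in> R\<^sup>+" by (rule rtrancl_into_trancl2[rotated])
    then show False using assms(1) by (auto simp: acyclic_def)
  qed
  then show ?case using Cons by auto
qed auto

text \<open>Acyclicity makes the distinctness of vertices automatic, so a path is just a chain of
  arcs. Chains can be cut and joined without checking for repeated vertices.\<close>

lemma acyclic_apath_iff:
  assumes "acyclic (parcs G)"
  shows "pre_digraph.apath (with_proj G) u p v \<longleftrightarrow>
    u \<in> pverts G \<and> set p \<subseteq> parcs G \<and> pcas u p v"
  using acyclic_distinct_pawalk_verts[OF assms]
  by (auto simp: pre_digraph.apath_def pre_digraph.awalk_def cas_with_proj_eq
      awalk_verts_with_proj_eq)

definition abp_paths :: "'x abp \<Rightarrow> (nat \<times> nat) list set" where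
  "abp_paths A = {p. pre_digraph.apath (with_proj (abp_graph A)) (abp_source A) p (abp_sink A)}"

lemma finite_abp_paths:
  assumes "is_abp X A"
  shows "finite (abp_paths A)"
proof -
  interpret pair_fin_digraph "abp_graph A" using assms by (simp add: is_abp_def)
  show ?thesis unfolding abp_paths_def by (rule apaths_finite)
qed

lemma abp_paths_iff:
  assumes "is_abp X A"
  shows "p \<in> abp_paths A \<longleftrightarrow>
    set p \<subseteq> parcs (abp_graph A) \<and> pcas (abp_source A) p (abp_sink A)"
proof -
  have "abp_source A \<in> pverts (abp_graph A)" using assms by (auto simp: is_abp_def)
  then show ?thesis
    using assms by (auto simp: abp_paths_def is_abp_def acyclic_apath_iff)
qed

text \<open>Both paths run through the endpoints of \<open>a\<close>, so the prefix of one fits the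
  suffix of the other. In a graph with cycles the splice might repeat a vertex; here it
  cannot.\<close>

lemma abp_paths_exchange:
  assumes "is_abp X A" "p @ a # q \<in> abp_paths A" "p' @ a # q' \<in> abp_paths A"
  shows "p @ a # q' \<in> abp_paths A"
  using assms(2,3) by (auto simp: abp_paths_iff[OF assms(1)] pcas_append)


section \<open>Monomials\<close>

primrec label_coeff :: "'x abp_label \<Rightarrow> rat" where
  "label_coeff (Var x) = 1"
| "label_coeff (Const c) = c"

primrec label_monom :: "'x abp_label \<Rightarrow> 'x \<Rightarrow>\<^sub>0 nat" where
  "label_monom (Var x) = Poly_Mapping.single x 1"
| "label_monom (Const c) = 0"

lemma label_poly_eq_single: "label_poly l = Poly_Mapping.single (label_monom l) (label_coeff l)"
  by (cases l) (simp_all add: pvar_def pconst_def)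

text \<open>Every label is a single term, hence so is the contribution of a whole path.\<close>

lemma prod_list_label_poly:
  "(\<Prod>l\<leftarrow>ls. label_poly l) =
    Poly_Mapping.single (\<Sum>l\<leftarrow>ls. label_monom l) (\<Prod>l\<leftarrow>ls. label_coeff l)"
  by (induction ls) (simp_all add: label_poly_eq_single mult_single)

text \<open>Natural exponents cannot cancel, so a product of monomials involves exactly the
  variables of its factors.\<close>

lemma keys_add_nat:
  "Poly_Mapping.keys (f + g :: 'x \<Rightarrow>\<^sub>0 nat) = Poly_Mapping.keys f \<union> Poly_Mapping.keys g"
  by (simp add: set_eq_iff in_keys_iff lookup_add)

lemma keys_sum_list_label_monom:
  "Poly_Mapping.keys (\<Sum>l\<leftarrow>ls. label_monom l) = {x. Var x \<in> set ls}"
proof (induction ls)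
  case (Cons l ls)
  then show ?case by (cases l) (auto simp: keys_add_nat)
qed simp

text \<open>A map that is not injective may identify edges, so exponents above one occur; the
  support then has fewer variables than there are edges.\<close>

definition hom_monom :: "'a set set \<Rightarrow> ('a \<Rightarrow> nat) \<Rightarrow> nat set \<Rightarrow>\<^sub>0 nat" where
  "hom_monom E \<phi> = (\<Sum>e\<in>E. Poly_Mapping.single (\<phi> ` e) 1)"

lemma prod_pvar_eq_single: "(\<Prod>e\<in>E. pvar (\<phi> ` e)) = Poly_Mapping.single (hom_monom E \<phi>) 1"
  unfolding hom_monom_def
  by (induction E rule: infinite_finite_induct) (simp_all add: pvar_def mult_single)

lemma keys_hom_monom:
  assumes "finite E"
  shows "Poly_Mapping.keys (hom_monom E \<phi>) = (\<lambda>e. \<phi> ` e) ` E"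
  unfolding hom_monom_def using assms
  by (induction E rule: finite_induct) (simp_all add: keys_add_nat)

text \<open>Monotone programs may carry the constant zero, and paths through it contribute nothing.
  The condition is imposed arc by arc so that splicing preserves it.\<close>

definition live_paths :: "'x abp \<Rightarrow> (nat \<times> nat) list set" where
  "live_paths A = {p \<in> abp_paths A. \<forall>a\<in>set p. label_coeff (abp_label A a) \<noteq> 0}"

definition path_vars :: "'x abp \<Rightarrow> (nat \<times> nat) list \<Rightarrow> 'x set" where
  "path_vars A p = {x. \<exists>a\<in>set p. abp_label A a = Var x}"

definition path_monom :: "'x abp \<Rightarrow> (nat \<times> nat) list \<Rightarrow> 'x \<Rightarrow>\<^sub>0 nat" where
  "path_monom A p = (\<Sum>a\<leftarrow>p. label_monom (abp_label A a))"

definition path_coeff :: "'x abp \<Rightarrow> (nat \<times> nat) list \<Rightarrow> rat" where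
  "path_coeff A p = (\<Prod>a\<leftarrow>p. label_coeff (abp_label A a))"

lemma keys_path_monom: "Poly_Mapping.keys (path_monom A p) = path_vars A p"
  using keys_sum_list_label_monom[of "map (abp_label A) p"]
  by (auto simp: path_monom_def path_vars_def comp_def image_iff) metis+

lemma lookup_abp_poly:
  "Poly_Mapping.lookup (abp_poly A) m =
    (\<Sum>p\<in>abp_paths A. path_coeff A p when path_monom A p = m)"
proof -
  have "(\<Prod>a\<leftarrow>p. label_poly (abp_label A a)) =
      Poly_Mapping.single (path_monom A p) (path_coeff A p)" for p
    using prod_list_label_poly[of "map (abp_label A) p"]
    by (simp add: path_monom_def path_coeff_def comp_def)
  then show ?thesis
    by (simp add: abp_poly_def abp_paths_def lookup_sum lookup_single)
qed

section \<open>Absence of cancellation in monotone programs\<close>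

lemma path_coeff_nonneg:
  assumes "is_abp X A" "monotone_abp A" "p \<in> abp_paths A"
  shows "0 \<le> path_coeff A p"
proof -
  have "0 \<le> label_coeff (abp_label A a)" if "a \<in> set p" for a
    using assms that by (cases "abp_label A a") (auto simp: abp_paths_iff monotone_abp_def)
  then show ?thesis unfolding path_coeff_def by (induction p) auto
qed

lemma live_paths_iff: "p \<in> live_paths A \<longleftrightarrow> p \<in> abp_paths A \<and> path_coeff A p \<noteq> 0"
  by (auto simp: live_paths_def path_coeff_def prod_list_zero_iff)

text \<open>A coefficient is a sum of non-negative path coefficients, so it vanishes only if every
  summand does. This is where monotonicity enters the lower bound.\<close>

lemma lookup_abp_poly_neq_0_iff:
  assumes "is_abp X A" "monotone_abp A"
  shows "Poly_Mapping.lookup (abp_poly A) m \<noteq> 0 \<longleftrightarrow>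
    (\<exists>p\<in>live_paths A. path_monom A p = m)"
  unfolding lookup_abp_poly
  using path_coeff_nonneg[OF assms] finite_abp_paths[OF assms(1)]
  by (subst sum_nonneg_eq_0_iff) (auto simp: live_paths_iff when_def)

lemma lookup_hom_poly_neq_0_iff:
  assumes "finite V"
  shows "Poly_Mapping.lookup (hom_poly V E n) m \<noteq> 0 \<longleftrightarrow>
    (\<exists>\<phi>\<in>graph_homs V E {1..n} (complete_edges {1..n}). hom_monom E \<phi> = m)"
proof -
  have "finite (graph_homs V E {1..n} (complete_edges {1..n}))"
    unfolding graph_homs_def using assms by (intro finite_Collect_conjI disjI1) (simp add: finite_PiE)
  then show ?thesis
    unfolding hom_poly_def lookup_sum prod_pvar_eq_single
    by (subst sum_nonneg_eq_0_iff) (auto simp: lookup_single when_def)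
qed

text \<open>Neither side has cancellation, so equal polynomials have the same monomials, and these
  are compared through their sets of variables. The lower bound uses both directions: homomorphisms
  yield live paths, and a spliced live path yields a homomorphism.\<close>

lemma live_path_vars_iff_hom:
  assumes "is_abp X A" "monotone_abp A" "abp_poly A = hom_poly V E n" "finite V" "finite E"
  shows "(\<exists>p\<in>live_paths A. path_vars A p = S) \<longleftrightarrow>
    (\<exists>\<phi>\<in>graph_homs V E {1..n} (complete_edges {1..n}). S = (\<lambda>e. \<phi> ` e) ` E)"
proof -
  have "(\<exists>p\<in>live_paths A. path_monom A p = m) \<longleftrightarrow>
      (\<exists>\<phi>\<in>graph_homs V E {1..n} (complete_edges {1..n}). hom_monom E \<phi> = m)" for m
    using lookup_abp_poly_neq_0_iff[OF assms(1,2)] lookup_hom_poly_neq_0_iff[OF assms(4)]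
      assms(3) by metis
  then show ?thesis
    using keys_path_monom[of A] keys_hom_monom[OF assms(5)] by metis
qed


section \<open>Pathwidth\<close>

text \<open>The single bag \<open>V\<close> guarantees that the minimum defining
  \<open>pathwidth\<close> ranges over a nonempty set.\<close>

lemma trivial_path_decomposition:
  assumes "E \<subseteq> complete_edges V"
  shows "path_decomposition V E [V]"
  unfolding path_decomposition_def
proof (intro conjI ballI)
  fix i assume "i \<in> V"
  then have "{j. j < length [V] \<and> i \<in> [V] ! j} = {0..0}" by auto
  then show "\<exists>a b. a \<le> b \<and> b < length [V] \<and> {j. j < length [V] \<and> i \<in> [V] ! j} = {a..b}"
    by (metis le_refl length_Cons zero_less_Suc)
qed (use assms in \<open>auto simp: complete_edges_def\<close>)

lemma pathwidth_le:
  "path_decomposition V E Bs \<Longrightarrow> pathwidth V E \<le> decomposition_width Bs"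
  unfolding pathwidth_def by (rule Least_le) auto

lemma pathwidth_less_card:
  assumes "simple_graph V E" "V \<noteq> {}"
  shows "pathwidth V E + 1 \<le> card V"
proof -
  have "pathwidth V E \<le> card V - 1"
    using pathwidth_le[OF trivial_path_decomposition[of E V]] assms
    by (simp add: simple_graph_def decomposition_width_def)
  moreover have "card V > 0" using assms by (simp add: simple_graph_def card_gt_0_iff)
  ultimately show ?thesis by linarith
qed

lemma obtain_optimal_path_decomposition:
  assumes "simple_graph V E"
  obtains Bs where "path_decomposition V E Bs" "\<And>B. B \<in> set Bs \<Longrightarrow> card B \<le> pathwidth V E + 1"
proof -
  have "\<exists>Bs. path_decomposition V E Bs \<and> decomposition_width Bs = pathwidth V E"
    unfolding pathwidth_def
    by (rule LeastI_ex) (use trivial_path_decomposition assms in \<open>auto simp: simple_graph_def\<close>)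
  then obtain Bs where Bs: "path_decomposition V E Bs" "decomposition_width Bs = pathwidth V E"
    by blast
  have "card B \<le> pathwidth V E + 1" if "B \<in> set Bs" for B
  proof -
    have "card B \<le> Max (card ` set Bs)" using that by simp
    then show ?thesis using Bs(2) by (simp add: decomposition_width_def)
  qed
  then show ?thesis using Bs(1) that by blast
qed

text \<open>Some bag of maximal size does it. Since the subtraction in
  \<open>decomposition_width\<close> truncates, the maximum must first be shown positive; the bag of
  an arbitrary vertex provides this.\<close>

lemma large_bag_exists:
  assumes "path_decomposition V E Bs" "finite V" "V \<noteq> {}"
  shows "\<exists>j<length Bs. pathwidth V E + 1 \<le> card (Bs ! j)"
proof -
  obtain v where "v \<in> V" using assms(3) by blast
  then obtain a b where ab: "a \<le> b" "b < length Bs" "{j. j < length Bs \<and> v \<in> Bs ! j} = {a..b}"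
    using assms(1) unfolding path_decomposition_def by blast
  then have "b \<in> {j. j < length Bs \<and> v \<in> Bs ! j}" by simp
  then have v: "v \<in> Bs ! b" "Bs ! b \<in> set Bs" by simp_all
  have fin: "finite B" if "B \<in> set Bs" for B
    using assms(1) that finite_subset[OF _ assms(2)] by (simp add: path_decomposition_def)
  have "1 \<le> card (Bs ! b)"
    using v(1) fin[OF v(2)] by (metis One_nat_def Suc_leI card_gt_0_iff empty_iff)
  also have "\<dots> \<le> Max (card ` set Bs)" using v by simp
  finally have "pathwidth V E + 1 \<le> Max (card ` set Bs)"
    using pathwidth_le[OF assms(1)] by (simp add: decomposition_width_def)
  moreover have "Max (card ` set Bs) \<in> card ` set Bs"
    using v by (intro Max_in) auto
  ultimately show ?thesis by (metis image_iff in_set_conv_nth)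
qed

text \<open>
  A linear arrangement of (a superset of) the edges induces a path decomposition: the bag at a
  position consists of the vertices met both at or before it and at or after it.
\<close>

lemma edge_arrangement_separation:
  fixes \<phi> :: "'a \<Rightarrow> 'b"
  assumes "finite V" "V \<noteq> {}" "V = \<Union>E" "inj_on \<phi> V"
    and edges: "(\<lambda>e. \<phi> ` e) ` E \<subseteq> set fs" and range: "\<Union>(set fs) \<subseteq> \<phi> ` V"
  shows "\<exists>j<length fs. pathwidth V E + 1 \<le>
    card (\<Union>(set (take (Suc j) fs)) \<inter> \<Union>(set (drop j fs)))"
proof -
  \<comment> \<open>Position \<open>j\<close> belongs to both sides, so an edge listed there is
    contained in its own bag.\<close>
  define B where "B j = \<Union>(set (take (Suc j) fs)) \<inter> \<Union>(set (drop j fs))" for j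
  define Bs where "Bs = map (\<lambda>j. {v \<in> V. \<phi> v \<in> B j}) [0..<length fs]"
  have B_iff: "x \<in> B j \<longleftrightarrow> (\<exists>a b. a \<le> j \<and> j \<le> b \<and> b < length fs \<and> x \<in> fs ! a \<and> x \<in> fs ! b)"
    if "j < length fs" for x j
  proof -
    have "x \<in> \<Union>(set (take (Suc j) fs)) \<longleftrightarrow> (\<exists>a\<le>j. x \<in> fs ! a)"
    proof
      assume "\<exists>a\<le>j. x \<in> fs ! a"
      then obtain a where a: "a \<le> j" "x \<in> fs ! a" by blast
      then have "take (Suc j) fs ! a = fs ! a" "a < length (take (Suc j) fs)" using that by auto
      then show "x \<in> \<Union>(set (take (Suc j) fs))" using a(2) by (metis UnionI nth_mem)
    next
      assume "x \<in> \<Union>(set (take (Suc j) fs))"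
      then obtain i where "i < Suc j" "x \<in> fs ! i" by (auto simp: in_set_conv_nth)
      then show "\<exists>a\<le>j. x \<in> fs ! a" by (intro exI[of _ i]) simp
    qed
    moreover have "x \<in> \<Union>(set (drop j fs)) \<longleftrightarrow> (\<exists>b. j \<le> b \<and> b < length fs \<and> x \<in> fs ! b)"
    proof
      assume "\<exists>b. j \<le> b \<and> b < length fs \<and> x \<in> fs ! b"
      then obtain b where b: "j \<le> b" "b < length fs" "x \<in> fs ! b" by blast
      then have "drop j fs ! (b - j) = fs ! b" "b - j < length (drop j fs)" by auto
      then show "x \<in> \<Union>(set (drop j fs))" using b(3) by (metis UnionI nth_mem)
    next
      assume "x \<in> \<Union>(set (drop j fs))"
      then obtain i where "i < length fs - j" "x \<in> fs ! (j + i)"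
        by (auto simp: in_set_conv_nth)
      then show "\<exists>b. j \<le> b \<and> b < length fs \<and> x \<in> fs ! b"
        by (intro exI[of _ "j + i"]) auto
    qed
    ultimately show ?thesis by (auto simp: B_def)
  qed
  have "path_decomposition V E Bs"
    unfolding path_decomposition_def
  proof (intro conjI ballI)
    fix e assume "e \<in> E"
    then obtain j where j: "j < length fs" "\<phi> ` e = fs ! j"
      using edges by (metis image_subset_iff in_set_conv_nth)
    have "e \<subseteq> Bs ! j"
      using j \<open>e \<in> E\<close> \<open>V = \<Union>E\<close> B_iff[OF j(1)] by (auto simp: Bs_def)
    moreover have "Bs ! j \<in> set Bs" using j(1) by (intro nth_mem) (simp add: Bs_def)
    ultimately show "\<exists>B\<in>set Bs. e \<subseteq> B" by (rule bexI)
  next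
    fix v assume "v \<in> V"
    then obtain e where "e \<in> E" "v \<in> e" using \<open>V = \<Union>E\<close> by blast
    define J where "J = {j. j < length fs \<and> \<phi> v \<in> fs ! j}"
    have "finite J" by (simp add: J_def)
    have "\<phi> ` e \<in> set fs" using edges \<open>e \<in> E\<close> by blast
    then have "J \<noteq> {}" using \<open>v \<in> e\<close> by (auto simp: J_def in_set_conv_nth)
    have MJ: "Min J \<in> J" "Max J \<in> J" using \<open>finite J\<close> \<open>J \<noteq> {}\<close> by auto
    \<comment> \<open>A vertex is present exactly from its first to its last occurrence in the
      arrangement, even at positions in between that do not meet it.\<close>
    have "{j. j < length Bs \<and> v \<in> Bs ! j} = {Min J..Max J}"
    proof (intro set_eqI iffI)
      fix j assume "j \<in> {j. j < length Bs \<and> v \<in> Bs ! j}"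
      then have "j < length fs" "\<phi> v \<in> B j" by (auto simp: Bs_def)
      then obtain a b where "a \<le> j" "j \<le> b" "a \<in> J" "b \<in> J"
        using B_iff by (auto simp: J_def)
      then show "j \<in> {Min J..Max J}"
        using \<open>finite J\<close> by (auto intro: order_trans[OF Min_le] order_trans[OF _ Max_ge])
    next
      fix j assume "j \<in> {Min J..Max J}"
      then show "j \<in> {j. j < length Bs \<and> v \<in> Bs ! j}"
        using MJ \<open>v \<in> V\<close> B_iff[of j "\<phi> v"] by (auto simp: Bs_def J_def)
    qed
    moreover have "Min J \<le> Max J" "Max J < length Bs"
      using MJ \<open>finite J\<close> by (auto simp: Bs_def J_def)
    ultimately show "\<exists>a b. a \<le> b \<and> b < length Bs \<and> {j. j < length Bs \<and> v \<in> Bs ! j} = {a..b}"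
      by blast
  qed (auto simp: Bs_def)
  from large_bag_exists[OF this assms(1,2)] obtain j
    where j: "j < length fs" "pathwidth V E + 1 \<le> card {v \<in> V. \<phi> v \<in> B j}"
    by (auto simp: Bs_def)
  \<comment> \<open>No foreign points occur in the arrangement, so the injective map \<phi> carries
    the bag bijectively onto \<open>B j\<close>.\<close>
  have "B j \<subseteq> \<phi> ` V"
    using range by (auto simp: B_def dest!: in_set_takeD)
  then have "B j = \<phi> ` {v \<in> V. \<phi> v \<in> B j}" by blast
  moreover have "card (\<phi> ` {v \<in> V. \<phi> v \<in> B j}) = card {v \<in> V. \<phi> v \<in> B j}"
    by (rule card_image) (rule inj_on_subset[OF \<open>inj_on \<phi> V\<close>], auto)
  ultimately have "card (B j) = card {v \<in> V. \<phi> v \<in> B j}" by simp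
  then show ?thesis using j unfolding B_def by auto
qed


section \<open>Lower bound\<close>

text \<open>By injectivity at least \<open>w\<close> arguments are sent into \<open>S\<close>.
  Choose a set \<open>X\<close> of exactly \<open>w\<close> of them, in at most
  \<open>2 ^ card V\<close> ways; then each argument in \<open>X\<close> has \<open>card S\<close>
  possible values and each other one \<open>card D\<close>.\<close>

lemma card_injective_maps_meeting_le:
  assumes "finite V" "finite D" "finite S"
  shows "card {\<phi> \<in> V \<rightarrow>\<^sub>E D. inj_on \<phi> V \<and> w \<le> card (\<phi> ` V \<inter> S)} \<le>
    2 ^ card V * (card S ^ w * card D ^ (card V - w))"
proof -
  define T where "T = {T. T \<subseteq> V \<and> card T = w}"
  have finP: "finite (Pi\<^sub>E V (\<lambda>i. if i \<in> X then S else D))" for X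
    using assms by (intro finite_PiE) auto
  have "{\<phi> \<in> V \<rightarrow>\<^sub>E D. inj_on \<phi> V \<and> w \<le> card (\<phi> ` V \<inter> S)} \<subseteq>
      (\<Union>X\<in>T. Pi\<^sub>E V (\<lambda>i. if i \<in> X then S else D))"
  proof
    fix \<phi> assume "\<phi> \<in> {\<phi> \<in> V \<rightarrow>\<^sub>E D. inj_on \<phi> V \<and> w \<le> card (\<phi> ` V \<inter> S)}"
    then have \<phi>: "\<phi> \<in> V \<rightarrow>\<^sub>E D" "inj_on \<phi> V" "w \<le> card (\<phi> ` V \<inter> S)" by auto
    have "\<phi> ` V \<inter> S = \<phi> ` {i \<in> V. \<phi> i \<in> S}" by auto
    also have "card \<dots> = card {i \<in> V. \<phi> i \<in> S}"
      by (rule card_image) (rule inj_on_subset[OF \<phi>(2)], auto)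
    finally obtain X where X: "X \<subseteq> {i \<in> V. \<phi> i \<in> S}" "card X = w"
      using \<phi>(3) by (metis obtain_subset_with_card_n)
    then have "X \<in> T" by (auto simp: T_def)
    moreover have "\<phi> \<in> Pi\<^sub>E V (\<lambda>i. if i \<in> X then S else D)"
      using \<phi>(1) X(1) by (auto simp: PiE_iff)
    ultimately show "\<phi> \<in> (\<Union>X\<in>T. Pi\<^sub>E V (\<lambda>i. if i \<in> X then S else D))" by blast
  qed
  moreover have finT: "finite T" using assms(1) by (simp add: T_def)
  ultimately have "card {\<phi> \<in> V \<rightarrow>\<^sub>E D. inj_on \<phi> V \<and> w \<le> card (\<phi> ` V \<inter> S)} \<le>
      card (\<Union>X\<in>T. Pi\<^sub>E V (\<lambda>i. if i \<in> X then S else D))"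
    using finP by (intro card_mono) auto
  also have "\<dots> \<le> (\<Sum>X\<in>T. card (Pi\<^sub>E V (\<lambda>i. if i \<in> X then S else D)))"
    using finT by (rule card_UN_le)
  also have "\<dots> = (\<Sum>X\<in>T. card S ^ w * card D ^ (card V - w))"
  proof (rule sum.cong[OF refl])
    fix X assume "X \<in> T"
    then have X: "X \<subseteq> V" "card X = w" by (auto simp: T_def)
    have "card (Pi\<^sub>E V (\<lambda>i. if i \<in> X then S else D)) = (\<Prod>i\<in>V. if i \<in> X then card S else card D)"
      using assms(1) by (simp add: card_PiE if_distrib)
    also have "\<dots> = (\<Prod>i\<in>V \<inter> X. card S) * (\<Prod>i\<in>V \<inter> - X. card D)"
      using assms(1) by (simp add: prod.If_cases)
    also have "\<dots> = (\<Prod>i\<in>X. card S) * (\<Prod>i\<in>V - X. card D)"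
      using X(1) by (intro arg_cong2[where f = times] prod.cong) auto
    finally show "card (Pi\<^sub>E V (\<lambda>i. if i \<in> X then S else D)) = card S ^ w * card D ^ (card V - w)"
      using X assms(1) by (simp add: card_Diff_subset finite_subset)
  qed
  also have "\<dots> \<le> 2 ^ card V * (card S ^ w * card D ^ (card V - w))"
  proof -
    have "T \<subseteq> Pow V" by (auto simp: T_def)
    then have "card T \<le> 2 ^ card V" using assms(1) by (metis card_Pow card_mono finite_Pow_iff)
    then show ?thesis by simp
  qed
  finally show ?thesis .
qed

section \<open>Counting the injective maps served by one arc\<close>

lemma graph_hom_image_Union:
  assumes "V = \<Union>E"
  shows "\<Union>((\<lambda>e. \<phi> ` e) ` E) = \<phi> ` V"
  using assms by auto

text \<open>The arcs of a path for \<phi> arrange the edges of the image of the graph, so at some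
  arc many vertices are met on both sides. Inclusion-exclusion turns this large intersection into a
  large sum of cardinalities, a form that allows sides of different paths to be combined. The arc
  \<open>a\<close> counts for both sides.\<close>

lemma injective_hom_path_split:
  assumes A: "is_abp X A" "monotone_abp A" "abp_poly A = hom_poly V E n"
    and V: "finite V" "V \<noteq> {}" "V = \<Union>E"
    and \<phi>: "\<phi> \<in> graph_homs V E {1..n} (complete_edges {1..n})" "inj_on \<phi> V"
  shows "\<exists>p a q. p @ a # q \<in> live_paths A \<and> \<Union>(path_vars A (p @ a # q)) = \<phi> ` V \<and>
    card V + (pathwidth V E + 1) \<le>
      card (\<Union>(path_vars A (p @ [a]))) + card (\<Union>(path_vars A (a # q)))"
proof -
  have "finite E" by (rule finite_UnionD) (simp add: V(1) flip: V(3))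
  have "\<exists>r\<in>live_paths A. path_vars A r = (\<lambda>e. \<phi> ` e) ` E"
    unfolding live_path_vars_iff_hom[OF A V(1) \<open>finite E\<close>]
    using \<phi>(1) by (rule bexI[rotated]) (rule refl)
  then obtain r where r: "r \<in> live_paths A" "path_vars A r = (\<lambda>e. \<phi> ` e) ` E"
    by (elim bexE)
  then have Ur: "\<Union>(path_vars A r) = \<phi> ` V" using graph_hom_image_Union[OF V(3)] by simp
  \<comment> \<open>Constants become empty sets, which keeps positions in the path and in the
    arrangement aligned without adding vertices.\<close>
  define f where "f a = (case abp_label A a of Var x \<Rightarrow> x | Const c \<Rightarrow> {})" for a
  have U_f: "\<Union>(set (map f q)) = \<Union>(path_vars A q)" for q
    by (force simp: f_def path_vars_def split: abp_label.splits)
  have "path_vars A r \<subseteq> set (map f r)"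
    by (force simp: f_def path_vars_def split: abp_label.splits)
  then obtain j where j: "j < length r" "pathwidth V E + 1 \<le>
      card (\<Union>(set (take (Suc j) (map f r))) \<inter> \<Union>(set (drop j (map f r))))"
    using edge_arrangement_separation[OF V \<phi>(2), of "map f r"] r(2) U_f[of r] Ur by auto
  define p a q where "p = take j r" and "a = r ! j" and "q = drop (Suc j) r"
  have split: "take (Suc j) r = p @ [a]" "drop j r = a # q" "r = p @ a # q"
    using j(1) by (auto simp: p_def a_def q_def take_Suc_conv_app_nth Cons_nth_drop_Suc id_take_nth_drop)
  let ?L = "\<Union>(path_vars A (p @ [a]))" and ?R = "\<Union>(path_vars A (a # q))"
  have LR: "?L \<union> ?R = \<phi> ` V"
    using Ur by (simp add: split(3) path_vars_def) blast
  then have "finite ?L" "finite ?R" using V(1) by (metis finite_Un finite_imageI)+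
  then have "card ?L + card ?R = card (?L \<union> ?R) + card (?L \<inter> ?R)" by (rule card_Un_Int)
  moreover have "card (?L \<union> ?R) = card V" using LR \<phi>(2) by (simp add: card_image)
  moreover have "pathwidth V E + 1 \<le> card (?L \<inter> ?R)"
    using j(2) U_f by (simp only: take_map drop_map split(1,2))
  ultimately show ?thesis using r(1) Ur split(3) by (intro exI[of _ p] exI[of _ a] exI[of _ q]) auto
qed

text \<open>
  All maps routed through one arc are compared with the one whose path meets the most vertices up
  to that arc.  Splicing the two paths yields a monomial of the polynomial, hence at most
  \<open>card V\<close> vertices, which forces the two images to share many vertices.
\<close>

lemma card_injective_homs_le:
  assumes A: "is_abp X A" "monotone_abp A" "abp_poly A = hom_poly V E n"
    and V: "finite V" "V \<noteq> {}" "V = \<Union>E"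
    and F: "F \<subseteq> graph_homs V E {1..n} (complete_edges {1..n})" "\<And>\<phi>. \<phi> \<in> F \<Longrightarrow> inj_on \<phi> V"
    and w: "w = pathwidth V E + 1"
  shows "card F \<le> abp_size A * (2 ^ card V * (card V ^ w * n ^ (card V - w)))"
proof -
  let ?U = "\<lambda>q. \<Union>(path_vars A q)"
  let ?C = "2 ^ card V * (card V ^ w * n ^ (card V - w))"
  have "finite E" by (rule finite_UnionD) (simp add: V(1) flip: V(3))
  \<comment> \<open>Prefix, arc and suffix are packed into one triple so that a single choice
    function fixes a split for each map.\<close>
  have "\<forall>\<phi>\<in>F. \<exists>z. (\<lambda>(p, a, q). p @ a # q \<in> live_paths A \<and> ?U (p @ a # q) = \<phi> ` V \<and>
    card V + w \<le> card (?U (p @ [a])) + card (?U (a # q))) z"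
  proof
    fix \<phi> assume "\<phi> \<in> F"
    then have "\<phi> \<in> graph_homs V E {1..n} (complete_edges {1..n})" "inj_on \<phi> V" using F by auto
    from injective_hom_path_split[OF A V this] obtain p a q where
      "p @ a # q \<in> live_paths A \<and> ?U (p @ a # q) = \<phi> ` V \<and>
        card V + w \<le> card (?U (p @ [a])) + card (?U (a # q))"
      unfolding w by (elim exE)
    then show "\<exists>z. (\<lambda>(p, a, q). p @ a # q \<in> live_paths A \<and>
      ?U (p @ a # q) = \<phi> ` V \<and> card V + w \<le> card (?U (p @ [a])) + card (?U (a # q))) z"
      by (intro exI[of _ "(p, a, q)"]) simp
  qed
  from bchoice[OF this] obtain Z where Z: "\<forall>\<phi>\<in>F. (\<lambda>(p, a, q). p @ a # q \<in> live_paths A \<and>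
      ?U (p @ a # q) = \<phi> ` V \<and> card V + w \<le> card (?U (p @ [a])) + card (?U (a # q))) (Z \<phi>)"
    by (elim exE)
  define P R Q where "P \<phi> = fst (Z \<phi>)" and "R \<phi> = fst (snd (Z \<phi>))" and "Q \<phi> = snd (snd (Z \<phi>))"
    for \<phi>
  have PRQ: "P \<phi> @ R \<phi> # Q \<phi> \<in> live_paths A" "?U (P \<phi> @ R \<phi> # Q \<phi>) = \<phi> ` V"
    "card V + w \<le> card (?U (P \<phi> @ [R \<phi>])) + card (?U (R \<phi> # Q \<phi>))" if "\<phi> \<in> F" for \<phi>
    using bspec[OF Z that] by (simp_all add: P_def R_def Q_def case_prod_beta)
  have F_PiE: "F \<subseteq> V \<rightarrow>\<^sub>E {1..n}" using F(1) by (auto simp: graph_homs_def)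
  then have "finite F" using V(1) by (meson finite_PiE finite_atLeastAtMost finite_subset)
  have arc: "card {\<phi> \<in> F. R \<phi> = a} \<le> ?C" (is "card ?Fa \<le> _") for a
  proof (cases "?Fa = {}")
    case False
    have "finite ?Fa" using \<open>finite F\<close> by simp
    define g where "g \<phi> = card (?U (P \<phi> @ [a]))" for \<phi>
    have "Max (g ` ?Fa) \<in> g ` ?Fa" using \<open>finite ?Fa\<close> False by (intro Max_in) auto
    then obtain \<psi> where \<psi>: "\<psi> \<in> ?Fa" "g \<psi> = Max (g ` ?Fa)" by auto
    have shared: "w \<le> card (\<phi> ` V \<inter> \<psi> ` V)" if "\<phi> \<in> ?Fa" for \<phi>
    proof -
      let ?L = "?U (P \<psi> @ [a])" and ?R = "?U (a # Q \<phi>)"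
      \<comment> \<open>By maximality, the prefix of \<psi> can replace that of \<phi> without
        lowering the sum.\<close>
      have "g \<phi> \<le> g \<psi>" using that \<open>finite ?Fa\<close> unfolding \<psi>(2) by (intro Max_ge) auto
      then have sum: "card V + w \<le> card ?L + card ?R"
        using PRQ(3)[of \<phi>] that by (simp add: g_def)
      have sub: "?L \<subseteq> \<psi> ` V" "?R \<subseteq> \<phi> ` V"
        using PRQ(2)[of \<psi>] PRQ(2)[of \<phi>] \<psi>(1) that by (auto simp: path_vars_def) blast+
      have "P \<psi> @ a # Q \<psi> \<in> live_paths A" "P \<phi> @ a # Q \<phi> \<in> live_paths A"
        using PRQ(1)[of \<psi>] PRQ(1)[of \<phi>] \<psi>(1) that by auto
      then have "P \<psi> @ a # Q \<phi> \<in> live_paths A"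
        unfolding live_paths_def using abp_paths_exchange[OF A(1)] by fastforce
      \<comment> \<open>The map \<theta> need not be injective: only the bound \<open>card V\<close>
        on the size of its image matters.\<close>
      then obtain \<theta> where "path_vars A (P \<psi> @ a # Q \<phi>) = (\<lambda>e. \<theta> ` e) ` E"
        using live_path_vars_iff_hom[OF A V(1) \<open>finite E\<close>] by metis
      then have "?U (P \<psi> @ a # Q \<phi>) = \<theta> ` V" using graph_hom_image_Union[OF V(3)] by simp
      moreover have "?U (P \<psi> @ a # Q \<phi>) = ?L \<union> ?R"
        by (simp add: path_vars_def) blast
      ultimately have "card (?L \<union> ?R) \<le> card V" using V(1) by (simp add: card_image_le)
      moreover have "card ?L + card ?R = card (?L \<union> ?R) + card (?L \<inter> ?R)"
        using finite_subset[OF sub(1)] finite_subset[OF sub(2)] V(1) by (intro card_Un_Int) simp_all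
      ultimately have "w \<le> card (?L \<inter> ?R)" using sum by linarith
      also have "\<dots> \<le> card (\<phi> ` V \<inter> \<psi> ` V)" using sub V(1) by (intro card_mono) auto
      finally show ?thesis .
    qed
    \<comment> \<open>One fixed image, that of \<psi>, meets all images in the fibre in at least
      \<open>w\<close> points, so the counting lemma applies.\<close>
    have "?Fa \<subseteq> {\<phi> \<in> V \<rightarrow>\<^sub>E {1..n}. inj_on \<phi> V \<and> w \<le> card (\<phi> ` V \<inter> \<psi> ` V)}"
      using shared F_PiE F(2) by auto
    then have "card ?Fa \<le> card {\<phi> \<in> V \<rightarrow>\<^sub>E {1..n}. inj_on \<phi> V \<and> w \<le> card (\<phi> ` V \<inter> \<psi> ` V)}"
      using V(1) by (intro card_mono finite_Collect_conjI disjI1) (simp_all add: finite_PiE)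
    also have "\<dots> \<le> 2 ^ card V * (card (\<psi> ` V) ^ w * card {1..n} ^ (card V - w))"
      using V(1) by (intro card_injective_maps_meeting_le) auto
    also have "card (\<psi> ` V) = card V" using \<psi>(1) F(2) by (simp add: card_image)
    finally show ?thesis by simp
  next
    case True
    then show ?thesis by (simp only: card.empty)
  qed
  have fin: "finite (parcs (abp_graph A))"
    using A(1) by (simp add: is_abp_def pair_fin_digraph_def pair_fin_digraph_axioms_def)
  have "R \<phi> \<in> parcs (abp_graph A)" if "\<phi> \<in> F" for \<phi>
    using PRQ(1)[OF that] by (simp add: live_paths_def abp_paths_iff[OF A(1)])
  then have "F = (\<Union>a\<in>parcs (abp_graph A). {\<phi> \<in> F. R \<phi> = a})" by auto
  then have "card F \<le> (\<Sum>a\<in>parcs (abp_graph A). card {\<phi> \<in> F. R \<phi> = a})"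
    using card_UN_le[OF fin, of "\<lambda>a. {\<phi> \<in> F. R \<phi> = a}"] by simp
  also have "\<dots> \<le> (\<Sum>a\<in>parcs (abp_graph A). ?C)" by (rule sum_mono) (rule arc)
  finally show ?thesis by (simp add: abp_size_def)
qed

text \<open>Sending vertex \<open>i\<close> into the \<open>i\<close>-th of \<open>k\<close>
  disjoint blocks of length \<open>n div k\<close> gives \<open>(n div k) ^ k\<close> injective
  maps, all of them homomorphisms into the complete graph. Comparison with the bound per arc and
  cancellation of \<open>n ^ (k - w)\<close> leave the claim.\<close>

lemma monotone_abp_size_lower_bound:
  assumes A: "is_abp X A" "monotone_abp A" "abp_poly A = hom_poly {1..k} E n"
    and E: "simple_graph {1..k} E" "{1..k} = \<Union>E" and k: "1 \<le> k" "k \<le> n"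
  shows "n ^ (pathwidth {1..k} E + 1) \<le> (4 * k\<^sup>2) ^ k * abp_size A"
proof -
  define w q where "w = pathwidth {1..k} E + 1" and "q = n div k"
  define F where "F = Pi\<^sub>E {1..k} (\<lambda>i. {(i - 1) * q + 1..i * q})"
  have "w \<le> k" using pathwidth_less_card[OF E(1)] k(1) by (simp add: w_def)
  have F_range: "\<phi> i \<in> {1..n}" if "\<phi> \<in> F" "i \<in> {1..k}" for \<phi> i
  proof -
    have "\<phi> i \<in> {(i - 1) * q + 1..i * q}" using that by (auto simp: F_def PiE_iff)
    moreover have "i * q \<le> k * q" using that by simp
    moreover have "k * q \<le> n" by (simp add: q_def)
    ultimately have "\<phi> i \<le> n" "1 \<le> \<phi> i" by (meson atLeastAtMost_iff order_trans le_add2)+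
    then show ?thesis by simp
  qed
  have F_inj: "inj_on \<phi> {1..k}" if "\<phi> \<in> F" for \<phi>
  proof (rule linorder_inj_onI')
    fix i j assume ij: "i \<in> {1..k}" "j \<in> {1..k}" "i < j"
    then have "\<phi> i \<le> i * q" "(j - 1) * q + 1 \<le> \<phi> j" using that by (auto simp: F_def PiE_iff)
    moreover have "i * q \<le> (j - 1) * q" using ij by (intro mult_right_mono) auto
    ultimately show "\<phi> i \<noteq> \<phi> j" by linarith
  qed
  have "F \<subseteq> graph_homs {1..k} E {1..n} (complete_edges {1..n})"
  proof
    fix \<phi> assume \<phi>: "\<phi> \<in> F"
    have "\<phi> ` e \<in> complete_edges {1..n}" if "e \<in> E" for e
    proof -
      have e: "e \<subseteq> {1..k}" "card e = 2"
        using E(1) that by (auto simp: simple_graph_def complete_edges_def)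
      then have "card (\<phi> ` e) = 2"
        using card_image[OF inj_on_subset[OF F_inj[OF \<phi>] e(1)]] by simp
      then show ?thesis using e(1) F_range[OF \<phi>] by (auto simp: complete_edges_def)
    qed
    moreover have "\<phi> \<in> {1..k} \<rightarrow>\<^sub>E {1..n}"
      using \<phi> F_range[OF \<phi>] by (auto simp: F_def PiE_iff)
    ultimately show "\<phi> \<in> graph_homs {1..k} E {1..n} (complete_edges {1..n})"
      by (simp add: graph_homs_def)
  qed
  then have "card F \<le> abp_size A * (2 ^ card {1..k} * (card {1..k} ^ w * n ^ (card {1..k} - w)))"
    using F_inj k(1) by (intro card_injective_homs_le[OF A _ _ E(2) _ _ w_def]) simp_all
  moreover have "card F = q ^ k"
  proof -
    have "card {(i - 1) * q + 1..i * q} = q" if "i \<in> {1..k}" for i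
      using that by (cases i) auto
    then have "(\<Prod>i\<in>{1..k}. card {(i - 1) * q + 1..i * q}) = (\<Prod>i\<in>{1..k}. q)"
      by (intro prod.cong) auto
    then show ?thesis by (simp add: F_def card_PiE)
  qed
  ultimately have q: "q ^ k \<le> abp_size A * (2 ^ k * (k ^ w * n ^ (k - w)))" by simp
  \<comment> \<open>Since \<open>k \<le> n\<close>, the quotient is positive, so the remainder is at
    most \<open>k * q\<close> and \<open>n\<close> at most doubles it.\<close>
  have "n = k * q + n mod k" "n mod k < k" using k(1) by (simp_all add: q_def)
  moreover have "k \<le> k * q" using k by (simp add: q_def div_greater_zero_iff Suc_le_eq)
  ultimately have "n \<le> 2 * k * q" by linarith
  then have "n ^ k \<le> (2 * k * q) ^ k" by (rule power_mono) simp
  also have "\<dots> = (2 * k) ^ k * q ^ k" by (simp add: power_mult_distrib)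
  \<comment> \<open>Weakening \<open>k ^ w\<close> to \<open>k ^ k\<close> makes the constant depend
    on \<open>k\<close> alone.\<close>
  also have "\<dots> \<le> (2 * k) ^ k * (abp_size A * (2 ^ k * (k ^ w * n ^ (k - w))))"
    using q by (rule mult_left_mono) simp
  also have "\<dots> \<le> (2 * k) ^ k * (abp_size A * (2 ^ k * (k ^ k * n ^ (k - w))))"
    using \<open>w \<le> k\<close> k(1) by (intro mult_left_mono mult_right_mono power_increasing) auto
  also have "\<dots> = (4 * k\<^sup>2) ^ k * abp_size A * n ^ (k - w)"
  proof -
    have "4 * k\<^sup>2 = (2 * k) * (2 * k)" by (simp add: power2_eq_square)
    then have "(4 * k\<^sup>2) ^ k = (2 * k) ^ k * (2 ^ k * k ^ k)" by (simp only: power_mult_distrib)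
    then show ?thesis by (simp only: ac_simps)
  qed
  finally have "n ^ w * n ^ (k - w) \<le> (4 * k\<^sup>2) ^ k * abp_size A * n ^ (k - w)"
    using \<open>w \<le> k\<close> by (simp flip: power_add)
  then have "n ^ w \<le> (4 * k\<^sup>2) ^ k * abp_size A" using k by simp
  then show ?thesis by (simp add: w_def)
qed


section \<open>Upper bound\<close>

text \<open>
  In layer \<open>j\<close> the program remembers only the restriction of the global map \<open>\<phi>\<close> to the bag
  \<open>B j\<close>; this restriction is encoded as the list of its values.
\<close>

definition layer_node :: "(nat \<Rightarrow> nat set) \<Rightarrow> nat \<Rightarrow> (nat \<Rightarrow> nat) \<Rightarrow> nat" where
  "layer_node B j \<phi> = prod_encode (j, list_encode (map \<phi> (sorted_list_of_set (B j))))"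

text \<open>The stored index separates layers even if their bags coincide. Within a layer, both
  lists run over the same vertices, so equal lists mean agreement on the bag.\<close>

lemma layer_node_eq_iff:
  assumes "finite (B j)"
  shows "layer_node B i \<phi> = layer_node B j \<psi> \<longleftrightarrow> i = j \<and> (\<forall>v\<in>B j. \<phi> v = \<psi> v)"
  using assms by (auto simp: layer_node_def prod_encode_eq list_encode_eq map_eq_conv)

definition layer_arc :: "(nat \<Rightarrow> nat set) \<Rightarrow> nat \<Rightarrow> (nat \<Rightarrow> nat) \<Rightarrow> nat \<times> nat" where
  "layer_arc B j \<phi> = (layer_node B j \<phi>, layer_node B (Suc j) \<phi>)"

definition layer_path :: "(nat \<Rightarrow> nat set) \<Rightarrow> nat \<Rightarrow> (nat \<Rightarrow> nat) \<Rightarrow> (nat \<times> nat) list" where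
  "layer_path B m \<phi> = map (\<lambda>j. layer_arc B j \<phi>) [0..<m]"

lemma pcas_layer_path: "pcas (layer_node B 0 \<phi>) (layer_path B m \<phi>) (layer_node B m \<phi>)"
  by (induction m) (auto simp: layer_path_def pcas_append layer_arc_def)

definition layer_arcs ::
  "(nat \<Rightarrow> nat set) \<Rightarrow> nat \<Rightarrow> (nat \<Rightarrow> nat) set \<Rightarrow> (nat \<times> nat) set" where
  "layer_arcs B m F = (\<Union>j<m. layer_arc B j ` F)"

text \<open>Different arcs of a walk may stem from different maps. They are merged one arc at a time
  into a single map: a vertex that has left the bags never returns, so forgetting its value causes
  no conflict.\<close>

lemma pcas_layer_arcs_imp_layer_path:
  assumes fin: "\<And>j. finite (B j)"
    and convex: "\<And>i j l v. i \<le> j \<Longrightarrow> j \<le> l \<Longrightarrow> v \<in> B i \<Longrightarrow> v \<in> B l \<Longrightarrow> v \<in> B j"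
    and "\<psi> \<in> V \<rightarrow>\<^sub>E D" "pcas (layer_node B 0 \<psi>) p x" "set p \<subseteq> layer_arcs B m (V \<rightarrow>\<^sub>E D)"
  shows "\<exists>\<phi>\<in>V \<rightarrow>\<^sub>E D. x = layer_node B (length p) \<phi> \<and> p = layer_path B (length p) \<phi>"
  using assms(4,5)
proof (induction p arbitrary: x rule: rev_induct)
  case Nil
  then show ?case using assms(3) by (auto simp: layer_path_def)
next
  case (snoc a p)
  from snoc.prems(1) have walk: "pcas (layer_node B 0 \<psi>) p (fst a)" and x: "x = snd a"
    by (auto simp: pcas_append)
  have "set p \<subseteq> layer_arcs B m (V \<rightarrow>\<^sub>E D)" using snoc.prems(2) by simp
  from snoc.IH[OF walk this] obtain \<phi> where \<phi>: "\<phi> \<in> V \<rightarrow>\<^sub>E D"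
    "fst a = layer_node B (length p) \<phi>" "p = layer_path B (length p) \<phi>"
    by (elim bexE conjE)
  have "a \<in> layer_arcs B m (V \<rightarrow>\<^sub>E D)" using snoc.prems(2) by simp
  then obtain j \<theta> where \<theta>: "\<theta> \<in> V \<rightarrow>\<^sub>E D" "a = layer_arc B j \<theta>"
    unfolding layer_arcs_def by blast
  let ?l = "length p"
  have "layer_node B j \<theta> = layer_node B ?l \<phi>" using \<phi>(2) \<theta>(2) by (simp add: layer_arc_def)
  then have j: "j = ?l" and agree: "\<forall>v\<in>B ?l. \<theta> v = \<phi> v"
    using layer_node_eq_iff[of B ?l j \<theta> \<phi>] fin by auto
  \<comment> \<open>Keep \<phi> on the vertices seen so far and take \<theta> on all others. A
    vertex of the next bag seen before lies in the current bag by convexity, and there the two maps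
    agree.\<close>
  define \<chi> where "\<chi> v = (if v \<in> (\<Union>i\<le>?l. B i) then \<phi> v else \<theta> v)" for v
  have "\<chi> \<in> V \<rightarrow>\<^sub>E D" using \<phi>(1) \<theta>(1) by (auto simp: \<chi>_def PiE_iff extensional_def)
  have early: "layer_node B i \<chi> = layer_node B i \<phi>" if "i \<le> ?l" for i
    using that fin by (auto simp: layer_node_eq_iff \<chi>_def)
  have "\<chi> v = \<theta> v" if "v \<in> B (Suc ?l)" for v
  proof (cases "v \<in> (\<Union>i\<le>?l. B i)")
    case True
    then obtain i where "i \<le> ?l" "v \<in> B i" by blast
    then have "v \<in> B ?l" using convex[of i ?l "Suc ?l" v] that by simp
    then show ?thesis using True agree by (simp add: \<chi>_def)
  qed (simp add: \<chi>_def)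
  then have late: "layer_node B (Suc ?l) \<chi> = layer_node B (Suc ?l) \<theta>"
    using fin by (simp add: layer_node_eq_iff)
  have "layer_path B ?l \<chi> = layer_path B ?l \<phi>"
    using early by (auto simp: layer_path_def layer_arc_def)
  moreover have "layer_arc B ?l \<chi> = a"
    using early[of ?l] late \<phi>(2) \<theta>(2) j by (simp add: layer_arc_def)
  moreover have "layer_path B (length (p @ [a])) \<chi> = layer_path B ?l \<chi> @ [layer_arc B ?l \<chi>]"
    by (simp add: layer_path_def)
  ultimately have "p @ [a] = layer_path B (length (p @ [a])) \<chi>"
    using \<phi>(3) by metis
  moreover have "x = layer_node B (length (p @ [a])) \<chi>"
    using x late \<theta>(2) j by (simp add: layer_arc_def)
  ultimately show ?case using \<open>\<chi> \<in> V \<rightarrow>\<^sub>E D\<close> by blast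
qed

text \<open>An arc depends only on the values of the map on two consecutive bags, which leaves at
  most \<open>card D ^ w\<close> arcs between two layers.\<close>

lemma card_layer_arcs_le:
  assumes "finite D" "D \<noteq> {}" "finite V" "\<And>j. B j \<subseteq> V"
    and "\<And>j. card (B j \<union> B (Suc j)) \<le> w"
  shows "card (layer_arcs B m (V \<rightarrow>\<^sub>E D)) \<le> m * card D ^ w"
proof -
  have "card (layer_arc B j ` (V \<rightarrow>\<^sub>E D)) \<le> card D ^ w" for j
  proof -
    let ?C = "B j \<union> B (Suc j)"
    have finB: "finite (B i)" for i using assms(3,4) finite_subset by metis
    have "layer_arc B j ` (V \<rightarrow>\<^sub>E D) \<subseteq> layer_arc B j ` (?C \<rightarrow>\<^sub>E D)"
    proof (rule image_subsetI)
      fix \<phi> assume \<phi>: "\<phi> \<in> V \<rightarrow>\<^sub>E D"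
      have "layer_arc B j \<phi> = layer_arc B j (restrict \<phi> ?C)"
        using finB by (simp add: layer_arc_def layer_node_eq_iff)
      moreover have "restrict \<phi> ?C \<in> ?C \<rightarrow>\<^sub>E D"
        using \<phi> assms(4)[of j] assms(4)[of "Suc j"] by (auto simp: PiE_iff)
      ultimately show "layer_arc B j \<phi> \<in> layer_arc B j ` (?C \<rightarrow>\<^sub>E D)" by (rule image_eqI)
    qed
    moreover have finC: "finite (?C \<rightarrow>\<^sub>E D)" using finB assms(1) by (intro finite_PiE) auto
    ultimately have "card (layer_arc B j ` (V \<rightarrow>\<^sub>E D)) \<le> card (layer_arc B j ` (?C \<rightarrow>\<^sub>E D))"
      by (intro card_mono) auto
    also have "\<dots> \<le> card (?C \<rightarrow>\<^sub>E D)" using finC by (rule card_image_le)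
    also have "\<dots> = card D ^ card ?C" using finB by (simp add: card_PiE)
    also have "\<dots> \<le> card D ^ w"
      using assms(1,2,5) by (intro power_increasing) (auto simp: Suc_le_eq card_gt_0_iff)
    finally show ?thesis .
  qed
  then have "(\<Sum>j<m. card (layer_arc B j ` (V \<rightarrow>\<^sub>E D))) \<le> (\<Sum>j<m. card D ^ w)"
    by (rule sum_mono)
  moreover have "card (layer_arcs B m (V \<rightarrow>\<^sub>E D)) \<le> (\<Sum>j<m. card (layer_arc B j ` (V \<rightarrow>\<^sub>E D)))"
    unfolding layer_arcs_def by (rule card_UN_le) simp
  ultimately show ?thesis by simp
qed

text \<open>Empty outer bags shrink the first and last layers to a single source and sink. Convexity
  makes every path come from one map, the covering of \<open>V\<close> makes that map unique, and
  locality makes labels well defined on arcs.\<close>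

lemma layered_abp_exists:
  fixes B :: "nat \<Rightarrow> nat set" and L :: "nat \<Rightarrow> (nat \<Rightarrow> nat) \<Rightarrow> 'x abp_label"
  assumes D: "finite D" "D \<noteq> {}" and V: "finite V" "V \<subseteq> (\<Union>j<m. B j)"
    and B: "\<And>j. B j \<subseteq> V" "B 0 = {}" "B m = {}" "\<And>j. card (B j \<union> B (Suc j)) \<le> w"
    and convex: "\<And>i j l v. i \<le> j \<Longrightarrow> j \<le> l \<Longrightarrow> v \<in> B i \<Longrightarrow> v \<in> B l \<Longrightarrow> v \<in> B j"
    and local: "\<And>j \<phi> \<psi>. (\<And>v. v \<in> B j \<union> B (Suc j) \<Longrightarrow> \<phi> v = \<psi> v) \<Longrightarrow> L j \<phi> = L j \<psi>"
    and vars: "\<And>j \<phi> x. \<phi> \<in> V \<rightarrow>\<^sub>E D \<Longrightarrow> L j \<phi> = Var x \<Longrightarrow> x \<in> X"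
    and nonneg: "\<And>j \<phi> c. \<phi> \<in> V \<rightarrow>\<^sub>E D \<Longrightarrow> L j \<phi> = Const c \<Longrightarrow> 0 \<le> c"
  shows "\<exists>A. is_abp X A \<and> monotone_abp A \<and>
    abp_poly A = (\<Sum>\<phi>\<in>V \<rightarrow>\<^sub>E D. \<Prod>j<m. label_poly (L j \<phi>)) \<and> abp_size A \<le> m * card D ^ w"
proof -
  define F where "F = V \<rightarrow>\<^sub>E D"
  have finB: "finite (B j)" for j using B(1) V(1) finite_subset by metis
  note node_eq = layer_node_eq_iff[of B, OF finB]
  have "finite F" using V(1) D(1) by (simp add: F_def finite_PiE)
  have "F \<noteq> {}" using D(2) by (simp add: F_def PiE_eq_empty_iff)
  then obtain \<phi>0 where \<phi>0: "\<phi>0 \<in> F" by blast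
  define s t where "s = layer_node B 0 \<phi>0" and "t = layer_node B m \<phi>0"
  have s: "layer_node B 0 \<phi> = s" and t: "layer_node B m \<phi> = t" for \<phi>
    using B(2,3) by (auto simp: s_def t_def node_eq)
  \<comment> \<open>Many maps share an arc. They agree on both of its bags, so by locality every
    choice gives the same label.\<close>
  define lab where "lab a = (SOME l. \<exists>j \<phi>. \<phi> \<in> F \<and> a = layer_arc B j \<phi> \<and> l = L j \<phi>)" for a
  have lab: "lab (layer_arc B j \<phi>) = L j \<phi>" if "\<phi> \<in> F" for j \<phi>
    unfolding lab_def
  proof (rule some_equality)
    fix l assume "\<exists>i \<psi>. \<psi> \<in> F \<and> layer_arc B j \<phi> = layer_arc B i \<psi> \<and> l = L i \<psi>"
    then obtain i \<psi> where "layer_arc B j \<phi> = layer_arc B i \<psi>" "l = L i \<psi>" by blast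
    then have "i = j" "\<forall>v\<in>B j \<union> B (Suc j). \<psi> v = \<phi> v"
      by (auto simp: layer_arc_def node_eq)
    then show "l = L j \<phi>" using local[of j \<psi> \<phi>] \<open>l = L i \<psi>\<close> by blast
  qed (use that in blast)
  define G :: "nat pair_pre_digraph" where
    "G = \<lparr>pverts = (\<Union>j\<le>m. layer_node B j ` F), parcs = layer_arcs B m F\<rparr>"
  define A where "A = \<lparr>abp_graph = G, abp_source = s, abp_sink = t, abp_label = lab\<rparr>"
  have G: "pverts G = (\<Union>j\<le>m. layer_node B j ` F)" "parcs G = layer_arcs B m F"
    by (simp_all add: G_def)
  have A: "abp_graph A = G" "abp_source A = s" "abp_sink A = t" "abp_label A = lab"
    by (simp_all add: A_def)
  have arcsE: "\<exists>j<m. \<exists>\<phi>\<in>F. a = layer_arc B j \<phi>" if "a \<in> parcs G" for a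
    using that by (auto simp: G layer_arcs_def)
  have arcsI: "layer_arc B j \<phi> \<in> parcs G" if "j < m" "\<phi> \<in> F" for j \<phi>
    using that by (auto simp: G layer_arcs_def)
  have "pair_fin_digraph G"
  proof
    show "finite (pverts G)" "finite (parcs G)" using \<open>finite F\<close> by (simp_all add: G layer_arcs_def)
    fix a assume "a \<in> parcs G"
    then obtain j \<phi> where "j < m" "\<phi> \<in> F" "a = layer_arc B j \<phi>" using arcsE by blast
    then have "fst a \<in> layer_node B j ` F" "snd a \<in> layer_node B (Suc j) ` F" "j \<le> m" "Suc j \<le> m"
      by (simp_all add: layer_arc_def)
    then show "fst a \<in> pverts G" "snd a \<in> pverts G" unfolding G by blast+
  qed
  moreover have "acyclic (parcs G)"
  \<comment> \<open>Arcs raise the layer index stored in a node; it is negated because the criterion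
    asks for a function decreasing along arcs.\<close>
  proof (rule acyclicI_order[where f = "\<lambda>x. - int (fst (prod_decode x))"])
    fix a b assume "(a, b) \<in> parcs G"
    then show "- int (fst (prod_decode b)) < - int (fst (prod_decode a))"
      using arcsE by (force simp: layer_arc_def layer_node_def)
  qed
  moreover have "{v \<in> pverts G. in_arcs (with_proj G) v = {}} = {s}"
  proof (intro set_eqI iffI)
    fix v assume v: "v \<in> {v \<in> pverts G. in_arcs (with_proj G) v = {}}"
    then obtain j \<phi> where j: "j \<le> m" "\<phi> \<in> F" "v = layer_node B j \<phi>" by (auto simp: G)
    show "v \<in> {s}"
    proof (cases j)
      case (Suc i)
      then have "layer_arc B i \<phi> \<in> in_arcs (with_proj G) v"
        using arcsI[of i \<phi>] j by (simp add: in_arcs_def layer_arc_def)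
      then show ?thesis using v by blast
    qed (use j s in simp)
  next
    fix v assume "v \<in> {s}"
    then have v: "v = layer_node B 0 \<phi>0" by (simp add: s_def)
    then have "v \<in> pverts G" using \<phi>0 by (auto simp: G)
    moreover have "in_arcs (with_proj G) v = {}"
      using arcsE by (fastforce simp: in_arcs_def v layer_arc_def node_eq)
    ultimately show "v \<in> {v \<in> pverts G. in_arcs (with_proj G) v = {}}" by simp
  qed
  moreover have "{v \<in> pverts G. out_arcs (with_proj G) v = {}} = {t}"
  proof (intro set_eqI iffI)
    fix v assume v: "v \<in> {v \<in> pverts G. out_arcs (with_proj G) v = {}}"
    then obtain j \<phi> where j: "j \<le> m" "\<phi> \<in> F" "v = layer_node B j \<phi>" by (auto simp: G)
    show "v \<in> {t}"
    proof (cases "j < m")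
      case True
      then have "layer_arc B j \<phi> \<in> out_arcs (with_proj G) v"
        using arcsI[of j \<phi>] j by (simp add: out_arcs_def layer_arc_def)
      then show ?thesis using v by blast
    qed (use j t in simp)
  next
    fix v assume "v \<in> {t}"
    then have v: "v = layer_node B m \<phi>0" by (simp add: t_def)
    then have "v \<in> pverts G" using \<phi>0 by (auto simp: G)
    moreover have "out_arcs (with_proj G) v = {}"
      using arcsE by (fastforce simp: out_arcs_def v layer_arc_def node_eq)
    ultimately show "v \<in> {v \<in> pverts G. out_arcs (with_proj G) v = {}}" by simp
  qed
  moreover have "\<forall>a\<in>parcs G. \<forall>x. lab a = Var x \<longrightarrow> x \<in> X"
    using arcsE lab vars unfolding F_def by metis
  ultimately have abp: "is_abp X A" by (simp add: is_abp_def A)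
  have mono: "monotone_abp A"
    unfolding monotone_abp_def A using arcsE lab nonneg unfolding F_def by metis
  have paths: "abp_paths A = layer_path B m ` F"
  proof (intro set_eqI iffI)
    fix p assume "p \<in> abp_paths A"
    then have p: "set p \<subseteq> layer_arcs B m (V \<rightarrow>\<^sub>E D)" "pcas (layer_node B 0 \<phi>0) p t"
      by (simp_all add: abp_paths_iff[OF abp] A G F_def s)
    have "\<exists>\<phi>\<in>V \<rightarrow>\<^sub>E D. t = layer_node B (length p) \<phi> \<and> p = layer_path B (length p) \<phi>"
      by (rule pcas_layer_arcs_imp_layer_path[OF finB _ \<phi>0[unfolded F_def] p(2,1)]) (rule convex)
    then obtain \<phi> where \<phi>: "\<phi> \<in> F" "t = layer_node B (length p) \<phi>" "p = layer_path B (length p) \<phi>"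
      unfolding F_def by (elim bexE conjE)
    then have "length p = m" by (simp add: t_def node_eq)
    then show "p \<in> layer_path B m ` F" using \<phi>(1,3) by (metis imageI)
  next
    fix p assume "p \<in> layer_path B m ` F"
    then obtain \<phi> where "\<phi> \<in> F" "p = layer_path B m \<phi>" by blast
    then show "p \<in> abp_paths A"
      using pcas_layer_path[of B \<phi> m] arcsI
      by (auto simp: abp_paths_iff[OF abp] A s t layer_path_def)
  qed
  \<comment> \<open>Without injectivity several maps would share a path and their terms would be
    counted only once.\<close>
  have inj: "inj_on (layer_path B m) F"
  proof (rule inj_onI)
    fix \<phi> \<psi> assume \<phi>\<psi>: "\<phi> \<in> F" "\<psi> \<in> F" "layer_path B m \<phi> = layer_path B m \<psi>"
    have "\<phi> v = \<psi> v" if v: "v \<in> V" for v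
    proof -
      obtain j where "j < m" "v \<in> B j" using v V(2) by blast
      moreover from this have "layer_node B j \<phi> = layer_node B j \<psi>"
        using \<phi>\<psi>(3) by (auto simp: layer_path_def layer_arc_def)
      ultimately show ?thesis by (simp add: node_eq)
    qed
    then show "\<phi> = \<psi>" using \<phi>\<psi>(1,2) unfolding F_def by (rule PiE_ext[rotated 2])
  qed
  have "abp_poly A = (\<Sum>p\<in>abp_paths A. \<Prod>a\<leftarrow>p. label_poly (lab a))"
    by (simp add: abp_poly_def abp_paths_def A)
  also have "\<dots> = (\<Sum>\<phi>\<in>F. \<Prod>a\<leftarrow>layer_path B m \<phi>. label_poly (lab a))"
    using inj by (simp add: paths sum.reindex)
  also have "\<dots> = (\<Sum>\<phi>\<in>F. \<Prod>j<m. label_poly (L j \<phi>))"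
  proof (rule sum.cong[OF refl])
    fix \<phi> assume "\<phi> \<in> F"
    then have "map (label_poly \<circ> lab) (layer_path B m \<phi>) = map (\<lambda>j. label_poly (L j \<phi>)) [0..<m]"
      by (simp add: layer_path_def lab)
    then show "(\<Prod>a\<leftarrow>layer_path B m \<phi>. label_poly (lab a)) = (\<Prod>j<m. label_poly (L j \<phi>))"
      by (simp add: comp_def atLeast0LessThan flip: prod.distinct_set_conv_list)
  qed
  finally have "abp_poly A = (\<Sum>\<phi>\<in>V \<rightarrow>\<^sub>E D. \<Prod>j<m. label_poly (L j \<phi>))" by (simp add: F_def)
  moreover have "abp_size A \<le> m * card D ^ w"
    using card_layer_arcs_le[of D V B w m, OF D V(1) B(1,4)] by (simp add: abp_size_def A G F_def)
  ultimately show ?thesis using abp mono by blast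
qed

section \<open>A program for the homomorphism polynomial\<close>

lemma hom_poly_abp_exists:
  fixes V :: "nat set"
  assumes "simple_graph V E"
  shows "\<exists>m. \<forall>n\<ge>1. \<exists>A. is_abp (complete_edges {1..n}) A \<and> monotone_abp A \<and>
    abp_poly A = hom_poly V E n \<and> abp_size A \<le> m * n ^ (pathwidth V E + 1)"
proof -
  have "finite V" and EV: "\<And>e. e \<in> E \<Longrightarrow> e \<subseteq> V"
    using assms by (auto simp: simple_graph_def complete_edges_def)
  have "E \<subseteq> Pow V" using EV by blast
  then have "finite E" using \<open>finite V\<close> by (simp add: finite_subset)
  obtain Bs where Bs: "path_decomposition V E Bs"
    and width: "\<And>C. C \<in> set Bs \<Longrightarrow> card C \<le> pathwidth V E + 1"
    using obtain_optimal_path_decomposition[OF assms] by blast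
  \<comment> \<open>Each bag is held for a block of \<open>N\<close> layers: residue 0 for the
    transition and residues 1 to \<open>card E\<close> for the edges. The spare residue keeps
    \<open>N > 1\<close> even without edges.\<close>
  define r N where "r = length Bs" and "N = card E + 2"
  \<comment> \<open>Bags are shifted by one and padded with empty sets, so that the intersections at
    both ends, \<open>B 0\<close> and \<open>B (r * N)\<close>, are empty.\<close>
  define b where "b i = (if 1 \<le> i \<and> i \<le> r then Bs ! (i - 1) else {})" for i
  have "N > 0" "N > 1" by (simp_all add: N_def)
  have b_sub: "b i \<subseteq> V" and b_card: "card (b i) \<le> pathwidth V E + 1" for i
    using Bs width[of "Bs ! (i - 1)"] by (auto simp: b_def r_def path_decomposition_def)
  have b_convex: "v \<in> b j" if "i \<le> j" "j \<le> l" "v \<in> b i" "v \<in> b l" for i j l v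
  proof -
    have "v \<in> V" using that(3) b_sub by blast
    then obtain x y where xy: "{j. j < length Bs \<and> v \<in> Bs ! j} = {x..y}"
      using Bs unfolding path_decomposition_def by blast
    have ran: "1 \<le> i" "l \<le> r" using that(3,4) by (auto simp: b_def split: if_splits)
    have mem: "z - 1 \<in> {x..y} \<longleftrightarrow> v \<in> b z" if "1 \<le> z" "z \<le> r" for z
      unfolding xy[symmetric] using that by (auto simp: b_def r_def)
    have "i - 1 \<in> {x..y}" "l - 1 \<in> {x..y}" using mem that ran by auto
    then have "j - 1 \<in> {x..y}" using that(1,2) by auto
    then show ?thesis using mem[of j] that(1,2) ran by simp
  qed
  \<comment> \<open>Between consecutive bags the walk passes through their intersection, and it stays in
    every bag long enough to multiply with each edge variable.\<close>
  define B where "B j = (if j mod N = 0 then b (j div N) \<inter> b (Suc (j div N)) else b (Suc (j div N)))"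
    for j
  have B_sub: "B j \<subseteq> b (Suc (j div N))" for j by (simp add: B_def)
  \<comment> \<open>Thanks to the intersection layers an arc never spans two different full bags;
    this keeps the exponent at \<open>pathwidth V E + 1\<close>.\<close>
  have B_step: "B j \<union> B (Suc j) \<subseteq> b (Suc (j div N))" for j
    using B_sub[of j] by (auto simp: B_def div_Suc mod_Suc split: if_splits)
  have B_card: "card (B j \<union> B (Suc j)) \<le> pathwidth V E + 1" for j
    using card_mono[OF finite_subset[OF b_sub \<open>finite V\<close>] B_step[of j]] b_card order_trans by blast
  have B_convex: "v \<in> B y" if "x \<le> y" "y \<le> z" "v \<in> B x" "v \<in> B z" for x y z v
  proof -
    have le: "x div N \<le> y div N" "y div N \<le> z div N" using that by (simp_all add: div_le_mono)
    have ends: "v \<in> b (Suc (x div N))" "v \<in> b (Suc (z div N))" using that B_sub by auto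
    have next_bag: "v \<in> b (Suc (y div N))"
      by (rule b_convex[OF _ _ ends]) (use le in auto)
    show ?thesis
    \<comment> \<open>Only a transition layer also requires membership in the previous bag. If
      \<open>x\<close> is strictly earlier, it lies in an earlier block, so convexity of the bags
      covers that one too.\<close>
    proof (cases "y mod N = 0 \<and> x \<noteq> y")
      case True
      have "x div N \<noteq> y div N"
      proof
        assume "x div N = y div N"
        then have "y \<le> x" using True by (metis add.right_neutral le_add1 mult_div_mod_eq)
        then show False using True that(1) by simp
      qed
      then have "v \<in> b (y div N)"
        by (intro b_convex[OF _ _ ends(1) next_bag]) (use le in auto)
      then show ?thesis using next_bag by (simp add: B_def)
    next
      case False
      then show ?thesis using that(3) next_bag by (auto simp: B_def)
    qed
  qed
  have "\<forall>e\<in>E. \<exists>c<r. e \<subseteq> Bs ! c"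
    using Bs unfolding path_decomposition_def r_def by (metis in_set_conv_nth)
  then obtain c where c: "\<And>e. e \<in> E \<Longrightarrow> c e < r \<and> e \<subseteq> Bs ! c e" by metis
  obtain h where h: "bij_betw h E {0..<card E}"
    using ex_bij_betw_finite_nat[OF \<open>finite E\<close>] by blast
  \<comment> \<open>Within the block of a bag containing \<open>e\<close>, the numbering
    \<open>h\<close> gives each edge its own layer; the successor avoids residue 0, where the bag
    may be incomplete.\<close>
  define pos where "pos e = c e * N + Suc (h e)" for e
  have h_less: "Suc (h e) < N" if "e \<in> E" for e
    using bij_betwE[OF h] that by (auto simp: N_def)
  have pos_div: "pos e div N = c e" and pos_mod: "pos e mod N = Suc (h e)" if "e \<in> E" for e
    using h_less[OF that] div_mult_self3[of N "c e" "Suc (h e)"]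
      mod_mult_self3[of "c e" N "Suc (h e)"] by (simp_all add: pos_def)
  have pos_inj: "inj_on pos E"
  proof (rule inj_onI)
    fix e f assume "e \<in> E" "f \<in> E" "pos e = pos f"
    then have "h e = h f" using pos_mod by (metis nat.inject)
    then show "e = f" using h \<open>e \<in> E\<close> \<open>f \<in> E\<close> by (auto simp: bij_betw_def dest: inj_onD)
  qed
  have pos_B: "e \<subseteq> B (pos e)" if "e \<in> E" for e
    using c[OF that] by (simp add: B_def b_def pos_div[OF that] pos_mod[OF that])
  have pos_less: "pos e < r * N" if "e \<in> E" for e
    using c[OF that] pos_div[OF that] \<open>N > 0\<close> by (simp add: div_less_iff_less_mult[symmetric])
  \<comment> \<open>An edge collapsed to a point gets the label zero, which removes maps that are
    not homomorphisms; layers without an edge contribute the factor one.\<close>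
  define L :: "nat \<Rightarrow> (nat \<Rightarrow> nat) \<Rightarrow> nat set abp_label" where
    "L j \<phi> = (if j \<in> pos ` E then
        let f = \<phi> ` inv_into E pos j in if card f = 2 then Var f else Const 0
      else Const 1)" for j \<phi>
  have L_pos: "L (pos e) \<phi> = (if card (\<phi> ` e) = 2 then Var (\<phi> ` e) else Const 0)"
    if "e \<in> E" for e \<phi>
    using that pos_inj by (simp add: L_def)
  have prod_L: "(\<Prod>j<r * N. label_poly (L j \<phi>)) = (\<Prod>e\<in>E. label_poly (L (pos e) \<phi>))" for \<phi>
  proof -
    have "(\<Prod>j<r * N. label_poly (L j \<phi>)) = (\<Prod>j\<in>pos ` E. label_poly (L j \<phi>))"
      using pos_less by (intro prod.mono_neutral_right) (auto simp: L_def pconst_def)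
    then show ?thesis using pos_inj by (simp add: prod.reindex)
  qed
  have poly: "(\<Sum>\<phi>\<in>V \<rightarrow>\<^sub>E {1..n}. \<Prod>j<r * N. label_poly (L j \<phi>)) = hom_poly V E n" for n
    unfolding hom_poly_def prod_L
  proof (rule sum.mono_neutral_cong_right)
    show "finite (V \<rightarrow>\<^sub>E {1..n})" using \<open>finite V\<close> by (simp add: finite_PiE)
    show "graph_homs V E {1..n} (complete_edges {1..n}) \<subseteq> V \<rightarrow>\<^sub>E {1..n}"
      by (simp add: graph_homs_def)
    show "\<forall>\<phi>\<in>(V \<rightarrow>\<^sub>E {1..n}) - graph_homs V E {1..n} (complete_edges {1..n}).
        (\<Prod>e\<in>E. label_poly (L (pos e) \<phi>)) = 0"
    proof
      fix \<phi> assume \<phi>: "\<phi> \<in> (V \<rightarrow>\<^sub>E {1..n}) - graph_homs V E {1..n} (complete_edges {1..n})"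
      then obtain e where e: "e \<in> E" "\<phi> ` e \<notin> complete_edges {1..n}"
        by (auto simp: graph_homs_def)
      have "\<phi> \<in> V \<rightarrow> {1..n}" using \<phi> by auto
      then have "\<phi> ` e \<subseteq> {1..n}" using EV[OF e(1)] by (metis funcset_image image_mono order_trans)
      then have "card (\<phi> ` e) \<noteq> 2" using e(2) by (simp add: complete_edges_def)
      then have "label_poly (L (pos e) \<phi>) = 0" using L_pos[OF e(1)] by (simp add: pconst_def)
      then show "(\<Prod>e\<in>E. label_poly (L (pos e) \<phi>)) = 0"
        using e(1) \<open>finite E\<close> by (meson prod_zero)
    qed
  next
    fix \<phi> assume "\<phi> \<in> graph_homs V E {1..n} (complete_edges {1..n})"
    then have "card (\<phi> ` e) = 2" if "e \<in> E" for e
      using that by (simp add: graph_homs_def complete_edges_def)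
    then show "(\<Prod>e\<in>E. label_poly (L (pos e) \<phi>)) = (\<Prod>e\<in>E. pvar (\<phi> ` e))"
      using L_pos by (intro prod.cong) simp_all
  qed
  have "\<exists>A. is_abp (complete_edges {1..n}) A \<and> monotone_abp A \<and>
      abp_poly A = (\<Sum>\<phi>\<in>V \<rightarrow>\<^sub>E {1..n}. \<Prod>j<r * N. label_poly (L j \<phi>)) \<and>
      abp_size A \<le> r * N * card {1..n} ^ (pathwidth V E + 1)" if "1 \<le> n" for n
  proof (rule layered_abp_exists[where B = B])
    show "V \<subseteq> (\<Union>j<r * N. B j)"
    proof
      fix v assume "v \<in> V"
      then obtain x y where xy: "x \<le> y" "{j. j < length Bs \<and> v \<in> Bs ! j} = {x..y}"
        using Bs unfolding path_decomposition_def by blast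
      then have "x \<in> {j. j < length Bs \<and> v \<in> Bs ! j}" by simp
      then have x: "x < r" "v \<in> Bs ! x" by (simp_all add: r_def)
      \<comment> \<open>Residue 1 is the first layer of the block that holds the full bag.\<close>
      have "(x * N + 1) div N = x" "(x * N + 1) mod N = 1"
        using div_mult_self3[of N x 1] mod_mult_self3[of x N 1] \<open>N > 1\<close> by simp_all
      then have "v \<in> B (x * N + 1)" "x * N + 1 < r * N"
        using x \<open>N > 0\<close> by (simp_all add: B_def b_def div_less_iff_less_mult[symmetric])
      then show "v \<in> (\<Union>j<r * N. B j)" by blast
    qed
    show "B j \<subseteq> V" for j using B_sub b_sub by blast
    show "B 0 = {}" "B (r * N) = {}" using \<open>N > 0\<close> by (simp_all add: B_def b_def)
    show "card (B j \<union> B (Suc j)) \<le> pathwidth V E + 1" for j by (rule B_card)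
    show "i \<le> j \<Longrightarrow> j \<le> l \<Longrightarrow> v \<in> B i \<Longrightarrow> v \<in> B l \<Longrightarrow> v \<in> B j" for i j l v by (rule B_convex)
    show "L j \<phi> = L j \<psi>" if "\<And>v. v \<in> B j \<union> B (Suc j) \<Longrightarrow> \<phi> v = \<psi> v" for j \<phi> \<psi>
    proof (cases "j \<in> pos ` E")
      case True
      then obtain e where e: "e \<in> E" "j = pos e" by blast
      have "\<phi> ` e = \<psi> ` e" using pos_B[OF e(1)] that e(2) by (intro image_cong) auto
      then show ?thesis using L_pos[OF e(1)] e(2) by simp
    qed (simp add: L_def)
    show "x \<in> complete_edges {1..n}" if "\<phi> \<in> V \<rightarrow>\<^sub>E {1..n}" "L j \<phi> = Var x" for j \<phi> x
    proof -
      have "j \<in> pos ` E" using that(2) by (auto simp: L_def split: if_splits)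
      then obtain e where e: "e \<in> E" "j = pos e" by blast
      have "x = \<phi> ` e" "card x = 2" using that(2) L_pos[OF e(1)] e(2) by (auto split: if_splits)
      moreover have "\<phi> \<in> V \<rightarrow> {1..n}" using that(1) by auto
      then have "\<phi> ` e \<subseteq> {1..n}" using EV[OF e(1)] by (metis funcset_image image_mono order_trans)
      ultimately show ?thesis by (simp add: complete_edges_def)
    qed
    show "0 \<le> a" if "L j \<phi> = Const a" for j \<phi> a
      using that by (auto simp: L_def Let_def split: if_splits)
  qed (use \<open>finite V\<close> that in auto)
  \<comment> \<open>The number of layers \<open>r * N\<close> is independent of \<open>n\<close> and
    serves as the constant.\<close>
  then show ?thesis unfolding poly by (intro exI[of _ "r * N"]) simp
qed

section \<open>Combining the two bounds\<close>

lemma connected_graph_Union_edges: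
  assumes "simple_graph V E" "connected_graph V E" "2 \<le> card V"
  shows "V = \<Union>E"
proof
  show "\<Union>E \<subseteq> V" using assms(1) by (auto simp: simple_graph_def complete_edges_def)
  show "V \<subseteq> \<Union>E"
  proof
    fix u assume u: "u \<in> V"
    have "V \<noteq> {u}" using assms(3) by auto
    then obtain v where v: "v \<in> V" "v \<noteq> u" using u by blast
    then have "(u, v) \<in> {(a, b). {a, b} \<in> E}\<^sup>*"
      using assms(2) u by (simp add: connected_graph_def)
    then obtain w where "{u, w} \<in> E" using v(2) by (auto elim: converse_rtranclE)
    then show "u \<in> \<Union>E" by blast
  qed
qed

theorem theorem2:
  fixes k :: nat and E :: "nat set set"
  assumes "simple_graph {1..k} E"
    and "connected_graph {1..k} E"
    and "k \<ge> 2"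
  shows "(\<lambda>n. real (min_monotone_abp_size (complete_edges {1..n}) (hom_poly {1..k} E n)))
           \<in> \<Theta>(\<lambda>n. real n ^ (pathwidth {1..k} E + 1))"
proof -
  let ?w = "pathwidth {1..k} E + 1"
  let ?f = "\<lambda>n. min_monotone_abp_size (complete_edges {1..n}) (hom_poly {1..k} E n)"
  obtain m where m: "\<forall>n\<ge>1. \<exists>A. is_abp (complete_edges {1..n}) A \<and> monotone_abp A \<and>
      abp_poly A = hom_poly {1..k} E n \<and> abp_size A \<le> m * n ^ ?w"
    using hom_poly_abp_exists[OF assms(1)] by blast
  \<comment> \<open>No vertex is isolated, so the variables of a monomial reveal the whole image of
    a map. For a single vertex the polynomial is the constant \<open>n\<close>, computed by one arc,
    so the bound would fail.\<close>
  have union: "{1..k} = \<Union>E" using connected_graph_Union_edges[OF assms(1,2)] assms(3) by simp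
  have upper: "?f n \<le> m * n ^ ?w" and lower: "n ^ ?w \<le> (4 * k\<^sup>2) ^ k * ?f n" if kn: "k \<le> n" for n
  proof -
    let ?P = "\<lambda>s. \<exists>A. is_abp (complete_edges {1..n}) A \<and> monotone_abp A \<and>
      abp_poly A = hom_poly {1..k} E n \<and> abp_size A = s"
    obtain A where A: "is_abp (complete_edges {1..n}) A" "monotone_abp A"
      "abp_poly A = hom_poly {1..k} E n" "abp_size A \<le> m * n ^ ?w"
      using m kn assms(3) by (meson le_trans one_le_numeral)
    then have "?P (abp_size A)" by blast
    \<comment> \<open>The program from the upper bound also shows that the minimum is attained,
      which gives the lower bound an actual program to act on.\<close>
    then have least: "?f n \<le> abp_size A" and ex: "?P (?f n)"
      unfolding min_monotone_abp_size_def by (rule Least_le, rule LeastI)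
    show "?f n \<le> m * n ^ ?w" using least A(4) by (rule order_trans)
    from ex obtain A' where A': "is_abp (complete_edges {1..n}) A'" "monotone_abp A'"
      "abp_poly A' = hom_poly {1..k} E n" "abp_size A' = ?f n"
      by (elim exE conjE)
    show "n ^ ?w \<le> (4 * k\<^sup>2) ^ k * ?f n"
      using monotone_abp_size_lower_bound[OF A'(1-3) assms(1) union _ kn] assms(3)
      by (simp add: A'(4))
  qed
  show ?thesis
  proof (rule bigthetaI)
    show "(\<lambda>n. real (?f n)) \<in> O(\<lambda>n. real n ^ ?w)"
    proof (rule bigoI[of _ "real m"])
      have "real (?f n) \<le> real m * real n ^ ?w" if "k \<le> n" for n
        using upper[OF that] by (metis of_nat_le_iff of_nat_mult of_nat_power)
      then show "\<forall>\<^sub>F n in sequentially. norm (real (?f n)) \<le> real m * norm (real n ^ ?w)"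
        by (intro eventually_sequentiallyI[of k]) simp
    qed
    have "(\<lambda>n. real n ^ ?w) \<in> O(\<lambda>n. real (?f n))"
    proof (rule bigoI[of _ "real ((4 * k\<^sup>2) ^ k)"])
      have "real n ^ ?w \<le> real ((4 * k\<^sup>2) ^ k) * real (?f n)" if "k \<le> n" for n
        using lower[OF that] by (metis of_nat_le_iff of_nat_mult of_nat_power)
      then show "\<forall>\<^sub>F n in sequentially. norm (real n ^ ?w) \<le> real ((4 * k\<^sup>2) ^ k) * norm (real (?f n))"
        by (intro eventually_sequentiallyI[of k]) simp
    qed
    then show "(\<lambda>n. real (?f n)) \<in> \<Omega>(\<lambda>n. real n ^ ?w)" by (simp add: bigomega_iff_bigo)
  qed
qed

end
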